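(* Let $\Omega\subset\mathbb{C}^n$ be an open set and let $K=k_1+\sqrt{-1}\,k_2:\Omega\to\mathbb{C}$ be a complex-valued structural function of class $C^2$. Then, for all $1\le i,j\le n$, the nonlinear structural Laplace operator $\frac{\mathrm{D}^2}{\partial z^i\partial\overline{z^j}}$ on $\Omega$, acting on complex-valued $C^2$ functions $w$, is $$\frac{\mathrm{D}^2}{\partial z^i\partial\overline{z^j}}=\frac{\partial^2}{\partial z^i\partial\overline{z^j}}+\left(\frac{\partial K}{\partial z^i}\frac{\partial}{\partial\overline{z^j}}+\frac{\partial K}{\partial\overline{z^j}}\frac{\partial}{\partial z^i}\right)+\left(\frac{\partial^2K}{\partial z^i\partial\overline{z^j}}+\frac{\partial K}{\partial z^i}\frac{\partial K}{\partial\overline{z^j}}\right),$$ where the last bracket acts on $w$ by multiplication.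
   Context: Coordinates on $\mathbb{C}^n$ are $z^i=x^i+\sqrt{-1}\,y^i$, $i=1,\dots,n$, with Wirtinger derivatives $\frac{\partial}{\partial z^i}=\frac12\left(\frac{\partial}{\partial x^i}-\sqrt{-1}\frac{\partial}{\partial y^i}\right)$ and $\frac{\partial}{\partial\overline{z^i}}=\frac12\left(\frac{\partial}{\partial x^i}+\sqrt{-1}\frac{\partial}{\partial y^i}\right)$. The generalized Wirtinger derivatives associated with $K$ are the operators $\frac{\mathrm{D}}{\partial z^i}=\frac{\partial}{\partial z^i}+\frac{\partial K}{\partial z^i}$ and $\frac{\mathrm{D}}{\partial\overline{z^i}}=\frac{\partial}{\partial\overline{z^i}}+\frac{\partial K}{\partial\overline{z^i}}$, where the derivatives of $K$ act by multiplication: $\frac{\mathrm{D}w}{\partial z^i}=\frac{\partial w}{\partial z^i}+w\frac{\partial K}{\partial z^i}$, and similarly for $\overline{z^i}$. The nonlinear structural Laplace operator is the composition of these operators, $\frac{\mathrm{D}^2}{\partial z^i\partial\overline{z^j}}w=\frac{\mathrm{D}}{\partial z^i}\left(\frac{\mathrm{D}w}{\partial\overline{z^j}}\right)$. *)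

theory Defs
  imports "HOL-Analysis.Analysis"
begin

text \<open>
  Real partial derivatives in the coordinates \<open>z\<^sup>i = x\<^sup>i + \<i> y\<^sup>i\<close>: the direction \<open>u = 1\<close> gives the
  derivative in \<open>x\<^sup>i\<close>, the direction \<open>u = \<i>\<close> the one in \<open>y\<^sup>i\<close>. Functions on an open set are
  represented by total functions; the derivatives at a point of the open set depend only on the
  values there.
\<close>

definition partial_differentiable ::
    "complex \<Rightarrow> 'n::finite \<Rightarrow> (complex^'n \<Rightarrow> complex) \<Rightarrow> complex^'n \<Rightarrow> bool" where
  "partial_differentiable u i f z \<longleftrightarrow> (\<lambda>t::real. f (z + t *\<^sub>R axis i u)) differentiable (at 0)"

definition partial_deriv ::
    "complex \<Rightarrow> 'n::finite \<Rightarrow> (complex^'n \<Rightarrow> complex) \<Rightarrow> complex^'n \<Rightarrow> complex" where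
  "partial_deriv u i f z = vector_derivative (\<lambda>t::real. f (z + t *\<^sub>R axis i u)) (at 0)"

text \<open>
  Class \<open>C\<^sup>k\<close> in the real sense: all real partial derivatives of order at most \<open>k\<close> exist and are
  continuous. Meant for open sets.
\<close>

primrec class_C :: "nat \<Rightarrow> (complex^'n::finite) set \<Rightarrow> (complex^'n \<Rightarrow> complex) \<Rightarrow> bool" where
  "class_C 0 S f \<longleftrightarrow> continuous_on S f"
| "class_C (Suc k) S f \<longleftrightarrow> continuous_on S f \<and>
     (\<forall>i. \<forall>u\<in>{1, \<i>}. (\<forall>z\<in>S. partial_differentiable u i f z) \<and> class_C k S (partial_deriv u i f))"

definition wirtinger ::
    "'n::finite \<Rightarrow> (complex^'n \<Rightarrow> complex) \<Rightarrow> complex^'n \<Rightarrow> complex" where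
  "wirtinger i f z = 1/2 * (partial_deriv 1 i f z - \<i> * partial_deriv \<i> i f z)"

definition wirtinger_bar ::
    "'n::finite \<Rightarrow> (complex^'n \<Rightarrow> complex) \<Rightarrow> complex^'n \<Rightarrow> complex" where
  "wirtinger_bar i f z = 1/2 * (partial_deriv 1 i f z + \<i> * partial_deriv \<i> i f z)"

definition gen_wirtinger ::
    "(complex^'n \<Rightarrow> complex) \<Rightarrow> 'n::finite \<Rightarrow> (complex^'n \<Rightarrow> complex) \<Rightarrow> complex^'n \<Rightarrow> complex" where
  "gen_wirtinger K i w z = wirtinger i w z + w z * wirtinger i K z"

definition gen_wirtinger_bar ::
    "(complex^'n \<Rightarrow> complex) \<Rightarrow> 'n::finite \<Rightarrow> (complex^'n \<Rightarrow> complex) \<Rightarrow> complex^'n \<Rightarrow> complex" where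
  "gen_wirtinger_bar K i w z = wirtinger_bar i w z + w z * wirtinger_bar i K z"

definition structural_laplace ::
    "(complex^'n \<Rightarrow> complex) \<Rightarrow> 'n::finite \<Rightarrow> 'n \<Rightarrow> (complex^'n \<Rightarrow> complex) \<Rightarrow> complex^'n \<Rightarrow> complex" where
  "structural_laplace K i j w = gen_wirtinger K i (gen_wirtinger_bar K j w)"

end

theory Submission
  imports Defs
begin

text \<open>
  Both Wirtinger operators are complex linear combinations of real directional derivatives, so
  \<open>wirtinger i\<close> obeys the sum rule and the Leibniz rule at every point where the partial derivatives
  in the \<open>x\<^sup>i\<close> and \<open>y\<^sup>i\<close> directions exist (\<open>wirtinger_add\<close>, \<open>wirtinger_mult\<close>). Writing \<open>f\<^sub>i\<close> for the
  \<open>z\<^sup>i\<close>-derivative and \<open>g\<close>, \<open>L\<close> for the conjugate \<open>z\<^sup>j\<close>-derivatives of \<open>w\<close>, \<open>K\<close>, the composed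
  operator is \<open>(g + w L)\<^sub>i + (g + w L) K\<^sub>i\<close>. The Leibniz rule turns the first summand into
  \<open>g\<^sub>i + w\<^sub>i L + w L\<^sub>i\<close>, and sorting terms by the order of the derivative that falls on \<open>w\<close> gives the
  formula. The Leibniz rule needs partial derivatives of \<open>w\<close>, \<open>g\<close> and \<open>L\<close>; for \<open>g\<close> and \<open>L\<close>,
  which are themselves first derivatives, they come from the \<open>C\<^sup>2\<close> hypotheses
  (\<open>class_C_2_wirtinger_bar_partial_differentiable\<close>).
\<close>

lemma partial_differentiable_has_vector_derivative:
  assumes "partial_differentiable u i f z"
  shows "((\<lambda>t::real. f (z + t *\<^sub>R axis i u)) has_vector_derivative partial_deriv u i f z) (at 0)"
  using assms unfolding partial_differentiable_def partial_deriv_def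
  by (simp add: vector_derivative_works)

lemma partial_derivI:
  assumes "((\<lambda>t::real. f (z + t *\<^sub>R axis i u)) has_vector_derivative d) (at 0)"
  shows "partial_differentiable u i f z" and "partial_deriv u i f z = d"
  using assms unfolding partial_differentiable_def partial_deriv_def
  by (auto simp: vector_derivative_at has_vector_derivative_def intro: differentiableI)

lemma
  assumes "partial_differentiable u i f z" and "partial_differentiable u i g z"
  shows partial_differentiable_add: "partial_differentiable u i (\<lambda>p. f p + g p) z"
    and partial_deriv_add:
      "partial_deriv u i (\<lambda>p. f p + g p) z = partial_deriv u i f z + partial_deriv u i g z"
  using partial_derivI[where f = "\<lambda>p. f p + g p", OF has_vector_derivative_add[OF
        assms[THEN partial_differentiable_has_vector_derivative]]]
  by simp_all

lemma
  assumes "partial_differentiable u i f z" and "partial_differentiable u i g z"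
  shows partial_differentiable_mult: "partial_differentiable u i (\<lambda>p. f p * g p) z"
    and partial_deriv_mult:
      "partial_deriv u i (\<lambda>p. f p * g p) z = f z * partial_deriv u i g z + partial_deriv u i f z * g z"
  using partial_derivI[where f = "\<lambda>p. f p * g p", OF has_vector_derivative_mult[OF
        assms[THEN partial_differentiable_has_vector_derivative]]]
  by simp_all

lemma partial_differentiable_cmult:
  assumes "partial_differentiable u i f z"
  shows "partial_differentiable u i (\<lambda>p. c * f p) z"
  using assms unfolding partial_differentiable_def by (intro differentiable_mult) auto

lemma wirtinger_add:
  assumes "\<forall>u\<in>{1, \<i>}. partial_differentiable u i f z"
    and "\<forall>u\<in>{1, \<i>}. partial_differentiable u i g z"
  shows "wirtinger i (\<lambda>p. f p + g p) z = wirtinger i f z + wirtinger i g z"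
  using assms by (simp add: wirtinger_def partial_deriv_add algebra_simps)

text \<open>
  The Leibniz rule passes from the two directional derivatives to their combination because the
  coefficients \<open>1/2\<close> and \<open>-\<i>/2\<close> are constants.
\<close>

lemma wirtinger_mult:
  assumes "\<forall>u\<in>{1, \<i>}. partial_differentiable u i f z"
    and "\<forall>u\<in>{1, \<i>}. partial_differentiable u i g z"
  shows "wirtinger i (\<lambda>p. f p * g p) z = wirtinger i f z * g z + f z * wirtinger i g z"
  using assms by (simp add: wirtinger_def partial_deriv_mult algebra_simps
      add_divide_distrib diff_divide_distrib)

lemma class_C_2_partial_differentiable:
  assumes "class_C 2 S f" and "z \<in> S" and "u \<in> {1, \<i>}"
  shows "partial_differentiable u i f z"
  using assms by (auto simp: numeral_2_eq_2)

lemma class_C_2_partial_deriv_partial_differentiable: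
  assumes "class_C 2 S f" and "z \<in> S" and "u \<in> {1, \<i>}" and "v \<in> {1, \<i>}"
  shows "partial_differentiable u i (partial_deriv v j f) z"
  using assms by (auto simp: numeral_2_eq_2)

lemma class_C_2_wirtinger_bar_partial_differentiable:
  assumes "class_C 2 S f" and "z \<in> S" and "u \<in> {1, \<i>}"
  shows "partial_differentiable u i (wirtinger_bar j f) z"
proof -
  have "partial_differentiable u i
      (\<lambda>p. 1/2 * (partial_deriv 1 j f p + \<i> * partial_deriv \<i> j f p)) z"
    by (intro partial_differentiable_cmult partial_differentiable_add
        class_C_2_partial_deriv_partial_differentiable[OF assms]) auto
  then show ?thesis
    by (simp add: wirtinger_bar_def[abs_def])
qed

theorem proposition2:
  fixes \<Omega> :: "(complex^'n::finite) set"
    and K w :: "complex^'n \<Rightarrow> complex"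
    and i j :: 'n
  assumes "open \<Omega>"
    and "class_C 2 \<Omega> K"
    and "class_C 2 \<Omega> w"
  shows "\<forall>z\<in>\<Omega>. structural_laplace K i j w z =
           wirtinger i (wirtinger_bar j w) z
           + (wirtinger i K z * wirtinger_bar j w z + wirtinger_bar j K z * wirtinger i w z)
           + (wirtinger i (wirtinger_bar j K) z + wirtinger i K z * wirtinger_bar j K z) * w z"
proof
  fix z assume z: "z \<in> \<Omega>"
  have w: "\<forall>u\<in>{1, \<i>}. partial_differentiable u i w z"
    using class_C_2_partial_differentiable[OF assms(3) z] by blast
  have w_bar: "\<forall>u\<in>{1, \<i>}. partial_differentiable u i (wirtinger_bar j w) z"
    using class_C_2_wirtinger_bar_partial_differentiable[OF assms(3) z] by blast
  have K_bar: "\<forall>u\<in>{1, \<i>}. partial_differentiable u i (wirtinger_bar j K) z"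
    using class_C_2_wirtinger_bar_partial_differentiable[OF assms(2) z] by blast
  have w_K_bar: "\<forall>u\<in>{1, \<i>}. partial_differentiable u i (\<lambda>p. w p * wirtinger_bar j K p) z"
    using w K_bar by (blast intro: partial_differentiable_mult)
  have "wirtinger i (gen_wirtinger_bar K j w) z =
      wirtinger i (\<lambda>p. wirtinger_bar j w p + w p * wirtinger_bar j K p) z"
    by (simp add: gen_wirtinger_bar_def[abs_def])
  also have "\<dots> = wirtinger i (wirtinger_bar j w) z
      + (wirtinger i w z * wirtinger_bar j K z + w z * wirtinger i (wirtinger_bar j K) z)"
    using wirtinger_add[OF w_bar w_K_bar] wirtinger_mult[OF w K_bar] by simp
  finally show "structural_laplace K i j w z =
           wirtinger i (wirtinger_bar j w) z
           + (wirtinger i K z * wirtinger_bar j w z + wirtinger_bar j K z * wirtinger i w z)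
           + (wirtinger i (wirtinger_bar j K) z + wirtinger i K z * wirtinger_bar j K z) * w z"
    by (simp add: structural_laplace_def gen_wirtinger_def gen_wirtinger_bar_def algebra_simps)
qed

end
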